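(* Let $d, m \geq 1$, let $\mathrm{Embed} : [0,1] \to \mathbb{R}^m$ be a map, let $f_{\boldsymbol{\theta}} : \mathbb{R}^{d+m} \to \mathbb{R}^d$ be a function, and fix $t_{\text{fixed}} \in (0,1]$. Suppose that the map $\boldsymbol{x} \mapsto f_{\boldsymbol{\theta}}([\boldsymbol{x}; \mathrm{Embed}(t_{\text{fixed}})])$ from $\mathbb{R}^d$ to $\mathbb{R}^d$ is $L$-Lipschitz continuous with respect to the Euclidean norm. Define the anomaly score $S_{\text{fixed}} : \mathbb{R}^d \to \mathbb{R}$ by $$S_{\text{fixed}}(\boldsymbol{x}) := \left\| f_{\boldsymbol{\theta}}\left([\boldsymbol{x}; \mathrm{Embed}(t_{\text{fixed}})]\right) + \boldsymbol{x} \right\|_2 .$$ Then $S_{\text{fixed}}$ is $(L+1)$-Lipschitz continuous with respect to $\boldsymbol{x}$, i.e., for all $\boldsymbol{x}_1, \boldsymbol{x}_2 \in \mathbb{R}^d$, $$|S_{\text{fixed}}(\boldsymbol{x}_1) - S_{\text{fixed}}(\boldsymbol{x}_2)| \leq (L+1)\, \| \boldsymbol{x}_1 - \boldsymbol{x}_2 \|_2 .$$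
   Context: $\|\cdot\|_2$ is the Euclidean norm. For $\boldsymbol{x} \in \mathbb{R}^d$ and $\boldsymbol{e} \in \mathbb{R}^m$, $[\boldsymbol{x}; \boldsymbol{e}] \in \mathbb{R}^{d+m}$ denotes concatenation. In the application, $f_{\boldsymbol{\theta}}$ is a neural network (a learned time-conditioned velocity field) with parameters $\boldsymbol{\theta}$ and $\mathrm{Embed}(t)$ is a fixed sinusoidal embedding of the scalar time $t \in [0,1]$; only the stated Lipschitz hypothesis is used as an assumption on $f_{\boldsymbol{\theta}}$. A map $g : \mathbb{R}^d \to \mathbb{R}^d$ is $L$-Lipschitz (with $L \ge 0$) with respect to the Euclidean norm if $\|g(\boldsymbol{x}_1) - g(\boldsymbol{x}_2)\|_2 \le L \|\boldsymbol{x}_1 - \boldsymbol{x}_2\|_2$ for all $\boldsymbol{x}_1, \boldsymbol{x}_2 \in \mathbb{R}^d$. *)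

theory Defs
  imports "HOL-Analysis.Analysis"
begin

(* The concatenation [x; e]: R^(d+m) is indexed by the disjoint sum of the two index types,
   so CARD('d + 'm) = CARD('d) + CARD('m). *)
definition vec_concat :: "real ^ 'd \<Rightarrow> real ^ 'm \<Rightarrow> real ^ ('d + 'm)" where
  "vec_concat x e = (\<chi> i. case i of Inl j \<Rightarrow> x $ j | Inr k \<Rightarrow> e $ k)"

definition anomaly_score ::
  "(real ^ ('d + 'm) \<Rightarrow> real ^ 'd) \<Rightarrow> (real \<Rightarrow> real ^ 'm) \<Rightarrow> real \<Rightarrow> real ^ 'd \<Rightarrow> real" where
  "anomaly_score f Embed t x = norm (f (vec_concat x (Embed t)) + x)"

end

theory Submission
  imports Defs
begin

text \<open>The score is the norm composed with the sum of an \<open>L\<close>-Lipschitz map and the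
  identity, which is 1-Lipschitz. Lipschitz constants add under sums
  (\<open>lipschitz_on_add\<close>), and the norm is 1-Lipschitz by the reverse triangle inequality
  (\<open>norm_triangle_ineq3\<close>), so the constant stays \<open>L + 1\<close>.\<close>

theorem proposition1:
  fixes Embed :: "real \<Rightarrow> real ^ 'm"
    and f :: "real ^ ('d + 'm) \<Rightarrow> real ^ 'd"
    and t_fixed L :: real
  assumes "t_fixed \<in> {0<..1}"
    and "L-lipschitz_on UNIV (\<lambda>x. f (vec_concat x (Embed t_fixed)))"
  shows "(L + 1)-lipschitz_on UNIV (anomaly_score f Embed t_fixed) \<and>
    (\<forall>x1 x2. \<bar>anomaly_score f Embed t_fixed x1 - anomaly_score f Embed t_fixed x2\<bar>
       \<le> (L + 1) * norm (x1 - x2))"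
proof -
  let ?g = "\<lambda>x. f (vec_concat x (Embed t_fixed)) + x"
  have "(L + 1)-lipschitz_on UNIV ?g"
    using assms(2) lipschitz_on_id by (rule lipschitz_on_add)
  then have g: "norm (?g x - ?g y) \<le> (L + 1) * norm (x - y)" for x y
    using lipschitz_onD by (fastforce simp: dist_norm)
  have S: "\<bar>anomaly_score f Embed t_fixed x - anomaly_score f Embed t_fixed y\<bar>
      \<le> (L + 1) * norm (x - y)" for x y
    unfolding anomaly_score_def using norm_triangle_ineq3 g by (rule order_trans)
  \<comment> \<open>\<open>lipschitz_on\<close> demands a nonnegative constant besides the distance
    bound; \<open>0 \<le> L\<close> is itself part of the Lipschitz hypothesis.\<close>
  have "0 \<le> L + 1"
    using lipschitz_on_nonneg[OF assms(2)] by simp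
  with S show ?thesis
    by (auto intro!: lipschitz_onI simp: dist_norm)
qed

end
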